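(* Let $0<\mu<L$ and $\kappa=\mu/L$. For any integer $K\ge 2$, with $\theta_K=\frac{2\pi}{K}$, the $K$-th roots-of-unity cycling region is $$\Omega_{K\text{-}\circ}(\mathcal F_{\mu,L})=\Big\{(\gamma,\beta)\in\Omega_{\mathrm{cv}}(\mathcal Q_{\mu,L})\ \Big|\ (\mu\gamma)^2-2\big[\beta-\cos\theta_K+\kappa(1-\beta\cos\theta_K)\big](\mu\gamma)+2\kappa(1-\cos\theta_K)(1+\beta^2-2\beta\cos\theta_K)\le 0\Big\}.$$ Moreover, for any $K\ge2$ and any $(\gamma,\beta)\in\Omega_{K\text{-}\circ}(\mathcal F_{\mu,L})$, the function $\psi:\mathbb R^2\to\mathbb R$, $$\psi(x)=\frac L2\|x\|^2-\frac{L-\mu}{2}\,d\big(x,\mathrm{conv}\{Mx_t^\circ:\ t=0,\dots,K-1\}\big)^2,\qquad M=\frac{(1+\beta-\mu\gamma)I_2-R-\beta R^{-1}}{(L-\mu)\gamma},$$ is a function such that $\mathrm{HB}_{\gamma,\beta}(\psi)$ cycles on $(x_0^\circ,\dots,x_{K-1}^\circ)$.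
   Context: For $0<\mu\le L$, $\mathcal F_{\mu,L}$ is the set of continuously differentiable functions $f:\mathbb R^d\to\mathbb R$ ($d\ge1$ arbitrary) that are $L$-smooth, $f(x)\le f(y)+\langle\nabla f(y),x-y\rangle+\frac L2\|x-y\|^2$, and $\mu$-strongly convex, $f(x)\ge f(y)+\langle\nabla f(y),x-y\rangle+\frac\mu2\|x-y\|^2$, for all $x,y$. For $\gamma,\beta\in\mathbb R$ and differentiable $f$, $\mathrm{HB}_{\gamma,\beta}(f)$ is the iteration $z_{t+1}=z_t-\gamma\nabla f(z_t)+\beta(z_t-z_{t-1})$, $t\ge1$, from initial points $z_0,z_1$. For $K$ points $(x_0,\dots,x_{K-1})$ not all equal, $\mathrm{HB}_{\gamma,\beta}(f)$ cycles on $(x_0,\dots,x_{K-1})$ if the sequence initialized at $z_0=x_0$, $z_1=x_1$ satisfies $z_t=x_{t\bmod K}$ for all $t\ge0$. $\Omega_{\mathrm{cv}}(\mathcal Q_{\mu,L})=\{(\gamma,\beta):\ \beta\in(-1,1),\ 0<\gamma<\frac2L(1+\beta)\}$ (the set of parameters for which heavy-ball converges on all quadratics with Hessian spectrum in $[\mu,L]$). Roots-of-unity cycle: $x_t^\circ=(\cos(t\theta_K),\sin(t\theta_K))^\top\in\mathbb R^2$, $t=0,\dots,K-1$, with $\theta_K=2\pi/K$; $R=\begin{pmatrix}\cos\theta_K&-\sin\theta_K\\ \sin\theta_K&\cos\theta_K\end{pmatrix}$. $\Omega_{K\text{-}\circ}(\mathcal F_{\mu,L})$ is the set of $(\gamma,\beta)\in\Omega_{\mathrm{cv}}(\mathcal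 Q_{\mu,L})$ for which there exists $f\in\mathcal F_{\mu,L}$ (on $\mathbb R^2$) such that $\mathrm{HB}_{\gamma,\beta}(f)$ cycles on $(x_0^\circ,\dots,x_{K-1}^\circ)$. $\mathrm{conv}$ is the convex hull, $d(x,C)$ the Euclidean distance from $x$ to the set $C$, $I_2$ the $2\times2$ identity. *)

theory Defs
  imports "HOL-Analysis.Analysis"
begin

text \<open>
  The gradient; it is meaningful at points where the function is differentiable.
\<close>

definition grad :: "('a::euclidean_space \<Rightarrow> real) \<Rightarrow> 'a \<Rightarrow> 'a" where
  "grad f x = (THE D. GDERIV f x :> D)"

definition smooth_strongly_convex :: "real \<Rightarrow> real \<Rightarrow> ('a::euclidean_space \<Rightarrow> real) set" where
  "smooth_strongly_convex \<mu> L = {f.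
     f differentiable_on UNIV \<and> continuous_on UNIV (grad f) \<and>
     (\<forall>x y. f x \<le> f y + grad f y \<bullet> (x - y) + L / 2 * (norm (x - y))\<^sup>2) \<and>
     (\<forall>x y. f x \<ge> f y + grad f y \<bullet> (x - y) + \<mu> / 2 * (norm (x - y))\<^sup>2)}"

fun heavy_ball ::
  "real \<Rightarrow> real \<Rightarrow> ('a::euclidean_space \<Rightarrow> real) \<Rightarrow> 'a \<Rightarrow> 'a \<Rightarrow> nat \<Rightarrow> 'a" where
  "heavy_ball \<gamma> \<beta> f z0 z1 0 = z0"
| "heavy_ball \<gamma> \<beta> f z0 z1 (Suc 0) = z1"
| "heavy_ball \<gamma> \<beta> f z0 z1 (Suc (Suc t)) =
     heavy_ball \<gamma> \<beta> f z0 z1 (Suc t)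
     - \<gamma> *\<^sub>R grad f (heavy_ball \<gamma> \<beta> f z0 z1 (Suc t))
     + \<beta> *\<^sub>R (heavy_ball \<gamma> \<beta> f z0 z1 (Suc t) - heavy_ball \<gamma> \<beta> f z0 z1 t)"

text \<open>
  The points of a cycle are given as a sequence of which only the first \<open>K\<close> terms matter.
  That they are not all equal forces \<open>K \<ge> 2\<close>, so \<open>x 1\<close> is one of them.
  Heavy-ball is only defined for differentiable functions, so differentiability is
  part of the predicate.
\<close>

definition hb_cycles ::
  "real \<Rightarrow> real \<Rightarrow> ('a::euclidean_space \<Rightarrow> real) \<Rightarrow> nat \<Rightarrow> (nat \<Rightarrow> 'a) \<Rightarrow> bool" where
  "hb_cycles \<gamma> \<beta> f K x \<longleftrightarrow>
     f differentiable_on UNIV \<and>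
     (\<exists>i<K. \<exists>j<K. x i \<noteq> x j) \<and>
     (\<forall>t. heavy_ball \<gamma> \<beta> f (x 0) (x 1) t = x (t mod K))"

text \<open>
  The parameters \<open>(\<gamma>, \<beta>)\<close> for which heavy-ball converges on all quadratics with Hessian
  spectrum in \<open>[\<mu>, L]\<close>; this region does not depend on \<open>\<mu>\<close>.
\<close>

definition Omega_cv :: "real \<Rightarrow> (real \<times> real) set" where
  "Omega_cv L = {(\<gamma>, \<beta>). \<beta> \<in> {-1<..<1} \<and> 0 < \<gamma> \<and> \<gamma> < 2 / L * (1 + \<beta>)}"

definition theta :: "nat \<Rightarrow> real" where
  "theta K = 2 * pi / real K"

definition unity_root :: "nat \<Rightarrow> nat \<Rightarrow> real ^ 2" where
  "unity_root K t = vector [cos (real t * theta K), sin (real t * theta K)]"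

definition rot :: "nat \<Rightarrow> real ^ 2 ^ 2" where
  "rot K = vector [vector [cos (theta K), - sin (theta K)],
                   vector [sin (theta K),   cos (theta K)]]"

definition Omega_circ :: "nat \<Rightarrow> real \<Rightarrow> real \<Rightarrow> (real \<times> real) set" where
  "Omega_circ K \<mu> L = {(\<gamma>, \<beta>). (\<gamma>, \<beta>) \<in> Omega_cv L \<and>
     (\<exists>f :: real ^ 2 \<Rightarrow> real. f \<in> smooth_strongly_convex \<mu> L \<and>
        hb_cycles \<gamma> \<beta> f K (unity_root K))}"

definition cycle_matrix :: "nat \<Rightarrow> real \<Rightarrow> real \<Rightarrow> real \<Rightarrow> real \<Rightarrow> real ^ 2 ^ 2" where
  "cycle_matrix K \<mu> L \<gamma> \<beta> =
     (1 / ((L - \<mu>) * \<gamma>)) *\<^sub>R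
       ((1 + \<beta> - \<mu> * \<gamma>) *\<^sub>R mat 1 - rot K - \<beta> *\<^sub>R matrix_inv (rot K))"

definition psi :: "nat \<Rightarrow> real \<Rightarrow> real \<Rightarrow> real \<Rightarrow> real \<Rightarrow> real ^ 2 \<Rightarrow> real" where
  "psi K \<mu> L \<gamma> \<beta> x =
     L / 2 * (norm x)\<^sup>2
     - (L - \<mu>) / 2 *
       (infdist x (convex hull ((\<lambda>t. cycle_matrix K \<mu> L \<gamma> \<beta> *v unity_root K t) ` {..<K})))\<^sup>2"

end

theory Submission
  imports Defs
begin

text \<open>
  On the roots-of-unity cycle the recursion prescribes the gradients, which are the
  iterates scaled and rotated by a fixed amount. Subtracting \<open>\<mu>/2 \<parallel>x\<parallel>\<^sup>2\<close> leaves a convex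
  function with \<open>(L - \<mu>)\<close>-Lipschitz gradient; its interpolation inequality between each point
  and its successor on the cycle has a constant gap, so summing over the cycle forces that gap
  to have the right sign, which is the quadratic condition. Conversely, \<open>\<psi>\<close> has gradient
  \<open>\<mu> x + (L - \<mu>) P x\<close> with \<open>P\<close> the projection onto the polygon with vertices \<open>M x\<^sub>t\<close>, so \<open>\<psi>\<close>
  cycles iff \<open>P x\<^sub>t = M x\<^sub>t\<close>. This is an obtuse-angle condition at each vertex of the polygon;
  the neighbouring vertex gives the quadratic condition again, and it implies the others
  because the cotangent is decreasing.
\<close>

section \<open>Smooth strongly convex functions\<close>

lemma grad_eqI:
  assumes "GDERIV f x :> D"
  shows "grad f x = D"
  unfolding grad_def
proof (rule the_equality[of _ D])
  fix E assume "GDERIV f x :> E"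
  then have "(\<lambda>h. h \<bullet> E) = (\<lambda>h. h \<bullet> D)"
    using assms unfolding gderiv_def by (blast intro: has_derivative_unique)
  then have "(E - D) \<bullet> E = (E - D) \<bullet> D"
    by meson
  then have "(E - D) \<bullet> (E - D) = 0"
    by (simp add: inner_diff_right)
  then show "E = D"
    by simp
qed (rule assms)

text \<open>The two bounds trap the remainder of the linear approximation between multiples of the
  squared norm of the increment. No signs of \<open>L\<close> and \<open>\<mu>\<close> are assumed,
  hence the absolute values in \<open>C\<close>.\<close>

lemma gderiv_of_quadratic_bounds:
  fixes f :: "'a::euclidean_space \<Rightarrow> real"
  assumes upper: "\<And>y. f y \<le> f x + D \<bullet> (y - x) + L / 2 * (norm (y - x))\<^sup>2"
    and lower: "\<And>y. f y \<ge> f x + D \<bullet> (y - x) + \<mu> / 2 * (norm (y - x))\<^sup>2"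
  shows "GDERIV f x :> D"
proof -
  define C where "C = \<bar>L\<bar> / 2 + \<bar>\<mu>\<bar> / 2"
  have bound: "norm (norm (f (x + h) - f x - h \<bullet> D) / norm h) \<le> C * norm h" for h
  proof -
    have "L / 2 * (norm h)\<^sup>2 \<le> C * (norm h)\<^sup>2" "(- C) * (norm h)\<^sup>2 \<le> \<mu> / 2 * (norm h)\<^sup>2"
      by (rule mult_right_mono; simp add: C_def; linarith)+
    then have "\<bar>f (x + h) - f x - h \<bullet> D\<bar> \<le> C * (norm h)\<^sup>2"
      using upper[of "x + h"] lower[of "x + h"] by (simp add: abs_le_iff inner_commute)
    then show ?thesis
      by (cases "h = 0") (simp_all add: divide_simps power2_eq_square mult.assoc)
  qed
  have "((\<lambda>h::'a. C * norm h) \<longlongrightarrow> 0) (at 0)"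
    by (intro tendsto_mult_right_zero tendsto_norm_zero tendsto_ident_at)
  then have "((\<lambda>h. norm (f (x + h) - f x - h \<bullet> D) / norm h) \<longlongrightarrow> 0) (at 0)"
    by (rule Lim_null_comparison[OF always_eventually, OF allI, OF bound])
  then show ?thesis
    unfolding gderiv_def has_derivative_at by (simp add: bounded_linear_inner_left)
qed

text \<open>This avoids differentiating a candidate: the two quadratic bounds already identify
  \<open>g\<close> as the gradient.\<close>

lemma smooth_strongly_convexI:
  fixes f :: "'a::euclidean_space \<Rightarrow> real"
  assumes upper: "\<And>x y. f x \<le> f y + g y \<bullet> (x - y) + L / 2 * (norm (x - y))\<^sup>2"
    and lower: "\<And>x y. f x \<ge> f y + g y \<bullet> (x - y) + \<mu> / 2 * (norm (x - y))\<^sup>2"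
    and cont: "continuous_on UNIV g"
  shows "grad f = g" and "f \<in> smooth_strongly_convex \<mu> L"
proof -
  have deriv: "GDERIV f x :> g x" for x
    by (rule gderiv_of_quadratic_bounds[OF upper lower])
  show grad: "grad f = g"
    by (rule ext) (rule grad_eqI[OF deriv])
  have "f differentiable_on UNIV"
    using deriv unfolding gderiv_def differentiable_on_def differentiable_def
    by auto
  then show "f \<in> smooth_strongly_convex \<mu> L"
    unfolding smooth_strongly_convex_def grad mem_Collect_eq
    by (intro conjI allI upper lower cont)
qed

text \<open>Evaluate the lower bound at \<open>y\<close> and the upper bound at \<open>x\<close> at the gradient step
  \<open>z = x - (G x - G y) / (L - \<mu>)\<close> of the convex function \<open>f - \<mu>/2 \<parallel>\<cdot>\<parallel>\<^sup>2\<close>.\<close>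

lemma smooth_strongly_convex_interpolation:
  fixes f :: "'a::euclidean_space \<Rightarrow> real" and \<mu> :: real
  defines "h \<equiv> \<lambda>x. f x - \<mu> / 2 * (norm x)\<^sup>2" and "G \<equiv> \<lambda>x. grad f x - \<mu> *\<^sub>R x"
  assumes f: "f \<in> smooth_strongly_convex \<mu> L" and "\<mu> < L"
  shows "h x \<ge> h y + G y \<bullet> (x - y) + (norm (G x - G y))\<^sup>2 / (2 * (L - \<mu>))"
proof -
  define z where "z = x - (1 / (L - \<mu>)) *\<^sub>R (G x - G y)"
  define Q where "Q = (norm (G x - G y))\<^sup>2 / (2 * (L - \<mu>))"
  have "h z \<le> h x + G x \<bullet> (z - x) + (L - \<mu>) / 2 * (norm (z - x))\<^sup>2"
  proof -
    have "f z \<le> f x + grad f x \<bullet> (z - x) + L / 2 * (norm (z - x))\<^sup>2"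
      using f unfolding smooth_strongly_convex_def by blast
    then show ?thesis
      unfolding h_def G_def power2_norm_eq_inner
      by (simp add: algebra_simps inner_commute) argo
  qed
  moreover have "h z \<ge> h y + G y \<bullet> (z - y)"
  proof -
    have "f z \<ge> f y + grad f y \<bullet> (z - y) + \<mu> / 2 * (norm (z - y))\<^sup>2"
      using f unfolding smooth_strongly_convex_def by blast
    then show ?thesis
      unfolding h_def G_def power2_norm_eq_inner
      by (simp add: algebra_simps inner_commute)
  qed
  moreover have "G y \<bullet> (z - y) = G y \<bullet> (z - x) + G y \<bullet> (x - y)"
    by (simp add: inner_diff_right)
  moreover have "G x \<bullet> (z - x) - G y \<bullet> (z - x) = - (2 * Q)"
    using \<open>\<mu> < L\<close>
    unfolding z_def Q_def power2_norm_eq_inner inner_diff_left[symmetric]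
    by (simp add: divide_simps)
  moreover have "(L - \<mu>) / 2 * (norm (z - x))\<^sup>2 = Q"
    using \<open>\<mu> < L\<close> by (simp add: z_def Q_def power_mult_distrib power2_eq_square)
  ultimately have "h x \<ge> h y + G y \<bullet> (x - y) + Q"
    by linarith
  then show ?thesis
    by (simp add: Q_def)
qed

section \<open>The squared distance to a convex set and its gradient\<close>

lemma infdist_closest_point:
  fixes S :: "'a::euclidean_space set"
  assumes "closed S" "S \<noteq> {}"
  shows "infdist x S = dist x (closest_point S x)"
  by (metis assms infdist_eq_setdist setdist_closest_point)

lemma
  fixes S :: "'a::euclidean_space set"
  assumes S: "convex S" "closed S" "S \<noteq> {}" and "\<mu> \<le> L"
  defines "f \<equiv> \<lambda>x. L / 2 * (norm x)\<^sup>2 - (L - \<mu>) / 2 * (infdist x S)\<^sup>2"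
  shows grad_dist_regularised:
      "grad f = (\<lambda>x. \<mu> *\<^sub>R x + (L - \<mu>) *\<^sub>R closest_point S x)" (is "_ = ?g")
    and smooth_strongly_convex_dist_regularised: "f \<in> smooth_strongly_convex \<mu> L"
proof -
  let ?P = "closest_point S"
  have d: "(infdist x S)\<^sup>2 = (norm (x - ?P x))\<^sup>2" for x
    using S by (simp add: infdist_closest_point dist_norm)
  \<comment> \<open>After expanding the squares this says that the squared distance lies above its
    linearisation at \<open>y\<close>, whose slope is \<open>2 (y - ?P y)\<close>. It follows from
    the obtuse angle at \<open>?P y\<close>.\<close>
  have upper: "f x \<le> f y + ?g y \<bullet> (x - y) + L / 2 * (norm (x - y))\<^sup>2" for x y
  proof -
    have "(y - ?P y) \<bullet> (?P x - ?P y) \<le> 0"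
      using S by (intro closest_point_dot closest_point_in_set)
    moreover have "0 \<le> (norm ((x - y) - (?P x - ?P y)))\<^sup>2"
      by simp
    ultimately have "(norm (x - ?P x))\<^sup>2 \<ge> (norm (y - ?P y))\<^sup>2 + 2 * ((y - ?P y) \<bullet> (x - y))"
      unfolding power2_norm_eq_inner by (simp add: algebra_simps inner_commute)
    then have "(L - \<mu>) / 2 * (norm (x - ?P x))\<^sup>2 \<ge>
        (L - \<mu>) / 2 * ((norm (y - ?P y))\<^sup>2 + 2 * ((y - ?P y) \<bullet> (x - y)))"
      using \<open>\<mu> \<le> L\<close> by (intro mult_left_mono) auto
    then show ?thesis
      unfolding f_def d power2_norm_eq_inner by (simp add: algebra_simps inner_commute) argo
  qed
  \<comment> \<open>Here the squared distance needs an upper bound; it comes from using the point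
    \<open>?P y\<close> of \<open>S\<close> as a competitor for the projection of
    \<open>x\<close>.\<close>
  have lower: "f x \<ge> f y + ?g y \<bullet> (x - y) + \<mu> / 2 * (norm (x - y))\<^sup>2" for x y
  proof -
    have "norm (x - ?P x) \<le> norm (x - ?P y)"
      using closest_point_le[of S "?P y" x] closest_point_in_set[of S y] S
      by (simp add: dist_norm)
    then have "(L - \<mu>) / 2 * (norm (x - ?P x))\<^sup>2 \<le> (L - \<mu>) / 2 * (norm (x - ?P y))\<^sup>2"
      using \<open>\<mu> \<le> L\<close> by (intro mult_left_mono power_mono) auto
    then show ?thesis
      unfolding f_def d power2_norm_eq_inner by (simp add: algebra_simps inner_commute) argo
  qed
  have "continuous_on UNIV ?g"
    using S by (intro continuous_intros continuous_on_closest_point)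
  from smooth_strongly_convexI[of f ?g, OF upper lower this]
  show "grad f = ?g" "f \<in> smooth_strongly_convex \<mu> L" .
qed

section \<open>Heavy-ball on the roots of unity\<close>

text \<open>A real angle as argument turns the rotations by \<open>theta K\<close> and its inverse
  into shifts of the angle.\<close>

definition circ :: "real \<Rightarrow> real ^ 2" where
  "circ a = vector [cos a, sin a]"

text \<open>
  With \<open>k = 1 + \<beta>\<close> this is \<open>\<gamma>\<close> times the gradient that heavy-ball needs at \<open>circ a\<close>.
\<close>

definition cycle_grad :: "real \<Rightarrow> real \<Rightarrow> real \<Rightarrow> real \<Rightarrow> real ^ 2" where
  "cycle_grad k \<beta> \<theta> a = k *\<^sub>R circ a - circ (a + \<theta>) - \<beta> *\<^sub>R circ (a - \<theta>)"

lemma circ_inner: "circ a \<bullet> circ b = cos (a - b)"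
  by (simp add: circ_def inner_vec_def sum_2 cos_diff)

text \<open>In the orthonormal frame of \<open>circ b\<close> and its counterclockwise tangent,
  \<open>cycle_grad k \<beta> \<theta> b\<close> has the coordinates
  \<open>k - (1 + \<beta>) * cos \<theta>\<close> and \<open>- (1 - \<beta>) * sin \<theta>\<close>,
  independent of \<open>b\<close>.\<close>

lemma circ_inner_cycle_grad:
  "circ a \<bullet> cycle_grad k \<beta> \<theta> b =
     (k - (1 + \<beta>) * cos \<theta>) * cos (b - a) + (1 - \<beta>) * sin \<theta> * sin (b - a)"
proof -
  have shift: "a - b = - (b - a)" "a - (b + \<theta>) = - ((b - a) + \<theta>)" "a - (b - \<theta>) = - ((b - a) - \<theta>)"
    by simp_all
  have "circ a \<bullet> cycle_grad k \<beta> \<theta> b =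
      k * cos (a - b) - cos (a - (b + \<theta>)) - \<beta> * cos (a - (b - \<theta>))"
    by (simp add: cycle_grad_def inner_diff_right circ_inner)
  then show ?thesis
    unfolding shift cos_minus cos_add[of "b - a" \<theta>] cos_diff[of "b - a" \<theta>]
    by (simp add: algebra_simps)
qed

text \<open>Since \<open>cycle_grad k \<beta> \<theta>\<close> is \<open>circ\<close> followed by a
  scaled rotation, inner products get multiplied by the square of the scale.\<close>

lemma cycle_grad_inner:
  "cycle_grad k \<beta> \<theta> a \<bullet> cycle_grad k \<beta> \<theta> b =
     ((k - (1 + \<beta>) * cos \<theta>)\<^sup>2 + ((1 - \<beta>) * sin \<theta>)\<^sup>2) * cos (b - a)"
proof -
  let ?w = "cycle_grad k \<beta> \<theta> b"
  have "cycle_grad k \<beta> \<theta> a \<bullet> ?w =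
      k * (circ a \<bullet> ?w) - circ (a + \<theta>) \<bullet> ?w - \<beta> * (circ (a - \<theta>) \<bullet> ?w)"
    by (simp add: cycle_grad_def[of k \<beta> \<theta> a] inner_diff_left)
  also have "\<dots> = ((k - (1 + \<beta>) * cos \<theta>)\<^sup>2 + ((1 - \<beta>) * sin \<theta>)\<^sup>2) * cos (b - a)"
  proof -
    have shift: "b - (a + \<theta>) = (b - a) - \<theta>" "b - (a - \<theta>) = (b - a) + \<theta>"
      by simp_all
    show ?thesis
      unfolding circ_inner_cycle_grad shift
        cos_diff[of "b - a" \<theta>] cos_add[of "b - a" \<theta>] sin_diff[of "b - a" \<theta>] sin_add[of "b - a" \<theta>]
      by (simp add: algebra_simps power2_eq_square)
  qed
  finally show ?thesis .
qed

section \<open>Trigonometry at multiples of \<open>theta K\<close>\<close>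

lemma cos_theta_less_1:
  assumes "K \<ge> 2"
  shows "cos (theta K) < 1"
  using cos_monotone_0_pi[of 0 "theta K"] assms by (simp add: theta_def field_simps)

lemma sin_theta_nonneg:
  assumes "K \<ge> 2"
  shows "sin (theta K) \<ge> 0"
  using assms by (intro sin_ge_zero) (auto simp: theta_def field_simps)

lemma unity_root_eq: "unity_root K t = circ (real t * theta K)"
  by (simp add: unity_root_def circ_def)

lemma unity_root_mod:
  assumes "K \<ge> 2"
  shows "unity_root K (t mod K) = unity_root K t"
proof -
  have "real t = real (t div K) * real K + real (t mod K)"
    by (simp only: div_mult_mod_eq flip: of_nat_mult of_nat_add)
  then have "real t * theta K = real (t mod K) * theta K + real (t div K) * (2 * pi)"
    using assms by (simp add: theta_def field_simps)
  moreover have "sin (real m * (2 * pi)) = 0" "cos (real m * (2 * pi)) = 1" for m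
    using sin_2npi[of m] cos_2npi[of m] by (simp_all add: mult.commute mult.left_commute)
  ultimately show ?thesis
    by (simp add: unity_root_def sin_add cos_add)
qed

text \<open>Writing \<open>\<phi>\<^sub>n = n \<theta> / 2\<close>, the reason is that \<open>cot \<phi>\<^sub>n \<le> cot \<phi>\<^sub>1\<close>.\<close>

lemma cot_condition_multiple:
  fixes K n :: nat and a b :: real
  assumes "K \<ge> 2" "n < K" "b \<ge> 0"
    and 1: "b * sin (theta K) \<le> a * (1 - cos (theta K))"
  shows "b * sin (n * theta K) \<le> a * (1 - cos (n * theta K))"
proof (cases "n = 0")
  case False
  define p where "p = pi / K"
  define q where "q = n * p"
  have dbl: "theta K = 2 * p" "n * theta K = 2 * q"
    by (auto simp: theta_def p_def q_def)
  have p: "0 < p" "p < pi" and q: "p \<le> q" "q < pi"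
    using assms False by (auto simp: p_def q_def field_simps)
  have sp: "sin p > 0" and sq: "sin q > 0" and sd: "sin (q - p) \<ge> 0"
    using p q by (auto intro!: sin_gt_zero sin_ge_zero)
  have half: "1 - cos (2 * x) = 2 * (sin x)\<^sup>2" for x :: real
    by (simp add: cos_double_sin)
  have "b * cos p \<le> a * sin p"
    using 1 sp unfolding dbl half sin_double power2_eq_square by (simp add: algebra_simps)
  then have "b * cos p * sin q \<le> a * sin p * sin q"
    using sq by (intro mult_right_mono) auto
  \<comment> \<open>This is \<open>cot q \<le> cot p\<close> with the denominators cleared,
    multiplied by \<open>b \<ge> 0\<close>.\<close>
  moreover have "b * (sin p * cos q) \<le> b * (sin q * cos p)"
    using sd \<open>b \<ge> 0\<close> by (intro mult_left_mono) (simp_all add: sin_diff mult.commute)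
  ultimately have "sin p * (b * cos q) \<le> sin p * (a * sin q)"
    by (simp add: algebra_simps)
  then have "b * cos q \<le> a * sin q"
    using sp by simp
  then have "sin q * (b * cos q) \<le> sin q * (a * sin q)"
    using sq by simp
  moreover have "b * sin (2 * q) = 2 * (sin q * (b * cos q))"
    "a * (1 - cos (2 * q)) = 2 * (sin q * (a * sin q))"
    unfolding half sin_double power2_eq_square by simp_all
  ultimately show ?thesis
    unfolding dbl(2) by linarith
qed simp

lemma unity_root_add_mult:
  assumes "K \<ge> 2"
  shows "unity_root K (t + K * m) = unity_root K t"
  using unity_root_mod[OF assms, of "t + K * m"] unity_root_mod[OF assms, of t] by simp

lemma cot_condition_all_multiples:
  fixes K n :: nat and a b :: real
  assumes "K \<ge> 2" "b \<ge> 0" "b * sin (theta K) \<le> a * (1 - cos (theta K))"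
  shows "b * sin (n * theta K) \<le> a * (1 - cos (n * theta K))"
proof -
  \<comment> \<open>The cosine and sine of \<open>n * theta K\<close> are the coordinates of a root
    of unity, so periodicity replaces \<open>n\<close> by \<open>n mod K\<close>.\<close>
  have "unity_root K (n mod K) $ i = unity_root K n $ i" for i
    using unity_root_mod[OF \<open>K \<ge> 2\<close>] by simp
  from this[of 1] this[of 2] show ?thesis
    using cot_condition_multiple[of K "n mod K" b a] assms by (simp add: unity_root_def)
qed

section \<open>The matrix \<open>M\<close> and the recursion on the cycle\<close>

lemma rot_inverse:
  fixes K :: nat
  defines "R' \<equiv> vector [vector [cos (theta K), sin (theta K)],
                        vector [- sin (theta K), cos (theta K)]] :: real ^ 2 ^ 2"
  shows "matrix_inv (rot K) = R'"
proof -
  have "rot K ** R' = mat 1" 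
    by (simp add: R'_def rot_def vec_eq_iff forall_2 matrix_matrix_mult_def sum_2 mat_def
        flip: power2_eq_square)
  moreover have "R' ** rot K = mat 1"
    by (simp add: R'_def rot_def vec_eq_iff forall_2 matrix_matrix_mult_def sum_2 mat_def
        flip: power2_eq_square)
  ultimately have eq: "rot K ** R' = mat 1 \<and> R' ** rot K = mat 1" ..
  \<comment> \<open>\<open>matrix_inv\<close> chooses some two-sided inverse; the witness
    \<open>R'\<close> shows that the choice does invert, and cancellation then identifies it with
    \<open>R'\<close>.\<close>
  have "matrix_inv (rot K) ** rot K = mat 1"
    unfolding matrix_inv_def
    by (rule someI2[where P = "\<lambda>A. rot K ** A = mat 1 \<and> A ** rot K = mat 1", OF eq])
      (rule conjunct2)
  then have "matrix_inv (rot K) ** (rot K ** R') = R'"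
    by (simp add: matrix_mul_assoc)
  then show ?thesis
    using eq by simp
qed

text \<open>So \<open>M\<close> sends a root to the gradient of
  \<open>f - \<mu>/2 \<parallel>\<cdot>\<parallel>\<^sup>2\<close> required there, divided by
  \<open>L - \<mu>\<close>.\<close>

lemma cycle_matrix_mult_unity_root:
  "cycle_matrix K \<mu> L \<gamma> \<beta> *v unity_root K t =
     (1 / ((L - \<mu>) * \<gamma>)) *\<^sub>R cycle_grad (1 + \<beta> - \<mu> * \<gamma>) \<beta> (theta K) (t * theta K)"
proof -
  have "rot K *v unity_root K t = circ (t * theta K + theta K)"
    "matrix_inv (rot K) *v unity_root K t = circ (t * theta K - theta K)"
    unfolding rot_inverse
    by (simp_all add: rot_def unity_root_def circ_def vec_eq_iff forall_2
        matrix_vector_mult_def sum_2 cos_add sin_add cos_diff sin_diff)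
  then show ?thesis
    unfolding cycle_matrix_def cycle_grad_def
    by (simp add: matrix_vector_mult_diff_rdistrib unity_root_eq flip: scaleR_matrix_vector_assoc)
qed

text \<open>Cycling means that any three consecutive roots satisfy the recursion, which can be
  solved for the gradient at the middle one. The middle index is \<open>Suc n\<close>; by
  periodicity this still reaches every root.\<close>

lemma hb_cycles_unity_root_iff:
  assumes K: "K \<ge> 2" and f: "f differentiable_on UNIV"
  shows "hb_cycles \<gamma> \<beta> f K (unity_root K) \<longleftrightarrow>
     (\<forall>n. \<gamma> *\<^sub>R grad f (unity_root K (Suc n)) =
        cycle_grad (1 + \<beta>) \<beta> (theta K) (Suc n * theta K))"
proof -
  let ?hb = "heavy_ball \<gamma> \<beta> f (unity_root K 0) (unity_root K 1)"
  have "unity_root K 0 $ 1 \<noteq> unity_root K 1 $ 1"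
    using cos_theta_less_1[OF K] by (simp add: unity_root_def)
  then have "unity_root K 0 \<noteq> unity_root K 1"
    by metis
  moreover have "0 < K" "1 < K"
    using K by simp_all
  ultimately have "\<exists>i<K. \<exists>j<K. unity_root K i \<noteq> unity_root K j"
    by blast
  then have "hb_cycles \<gamma> \<beta> f K (unity_root K) \<longleftrightarrow> (\<forall>t. ?hb t = unity_root K t)"
    using f by (simp add: hb_cycles_def unity_root_mod[OF K])
  also have "\<dots> \<longleftrightarrow> (\<forall>n. unity_root K (Suc (Suc n)) =
      unity_root K (Suc n) - \<gamma> *\<^sub>R grad f (unity_root K (Suc n))
        + \<beta> *\<^sub>R (unity_root K (Suc n) - unity_root K n))" (is "?l \<longleftrightarrow> (\<forall>n. ?rec n)")
  proof
    assume ?l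
    then show "\<forall>n. ?rec n"
      by (metis heavy_ball.simps(3))
  next
    assume rec: "\<forall>n. ?rec n"
    \<comment> \<open>The recursion has order two, so the induction carries two consecutive
      terms.\<close>
    have "?hb n = unity_root K n \<and> ?hb (Suc n) = unity_root K (Suc n)" for n
      using rec by (induction n) auto
    then show ?l
      by blast
  qed
  also have "\<dots> \<longleftrightarrow> (\<forall>n. \<gamma> *\<^sub>R grad f (unity_root K (Suc n)) =
      cycle_grad (1 + \<beta>) \<beta> (theta K) (Suc n * theta K))"
  proof (intro all_cong1)
    fix n
    have "Suc n * theta K + theta K = Suc (Suc n) * theta K"
      "Suc n * theta K - theta K = n * theta K"
      by (simp_all add: algebra_simps)
    then have "cycle_grad (1 + \<beta>) \<beta> (theta K) (Suc n * theta K) =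
        (1 + \<beta>) *\<^sub>R unity_root K (Suc n) - unity_root K (Suc (Suc n)) - \<beta> *\<^sub>R unity_root K n"
      by (simp only: cycle_grad_def unity_root_eq)
    also have "\<dots> = unity_root K (Suc n) + \<beta> *\<^sub>R (unity_root K (Suc n) - unity_root K n)
        - unity_root K (Suc (Suc n))"
      by (simp add: algebra_simps)
    finally have rhs: "cycle_grad (1 + \<beta>) \<beta> (theta K) (Suc n * theta K) = \<dots>" .
    have "v = p - x + r \<longleftrightarrow> x = p + r - v" for v p x r :: "real ^ 2"
      by (auto simp: algebra_simps)
    then show "?rec n \<longleftrightarrow> \<gamma> *\<^sub>R grad f (unity_root K (Suc n)) =
        cycle_grad (1 + \<beta>) \<beta> (theta K) (Suc n * theta K)"
      unfolding rhs .
  qed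
  finally show ?thesis .
qed

text \<open>With \<open>m = \<mu> * \<gamma>\<close> this is the passage from \<open>f\<close> to
  \<open>f - \<mu>/2 \<parallel>\<cdot>\<parallel>\<^sup>2\<close>.\<close>

lemma cycle_grad_shift:
  "cycle_grad (k - m) \<beta> \<theta> a = cycle_grad k \<beta> \<theta> a - m *\<^sub>R circ a"
  by (simp add: cycle_grad_def algebra_simps)

text \<open>The difference of the two sides, times \<open>\<kappa> > 0\<close>, is the polynomial
  times \<open>1 - c > 0\<close>: the factor \<open>1 - c\<close> splits off by
  \<open>s\<^sup>2 = (1 - c) * (1 + c)\<close>, and \<open>\<kappa>D\<close> eliminates
  \<open>L\<close> in favour of \<open>\<kappa>\<close>.\<close>

lemma region_polynomial_iff:
  fixes \<mu> L \<gamma> \<beta> c s :: real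
  defines "A \<equiv> 1 + \<beta> - \<mu> * \<gamma> - (1 + \<beta>) * c" and "B \<equiv> (1 - \<beta>) * s" and "D \<equiv> (L - \<mu>) * \<gamma>"
    and "\<kappa> \<equiv> \<mu> / L"
  assumes "0 < \<mu>" "\<mu> < L" "c < 1" and cs: "s\<^sup>2 + c\<^sup>2 = 1"
  shows "D * B * s \<le> (D * A - (A\<^sup>2 + B\<^sup>2)) * (1 - c) \<longleftrightarrow>
     (\<mu> * \<gamma>)\<^sup>2 - 2 * (\<beta> - c + \<kappa> * (1 - \<beta> * c)) * (\<mu> * \<gamma>)
       + 2 * \<kappa> * (1 - c) * (1 + \<beta>\<^sup>2 - 2 * \<beta> * c) \<le> 0" (is "_ \<longleftrightarrow> ?Q \<le> 0")
proof -
  have "\<kappa> > 0" and \<kappa>D: "\<kappa> * D = (1 - \<kappa>) * (\<mu> * \<gamma>)"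
    using assms by (simp_all add: \<kappa>_def D_def field_simps)
  have "\<kappa> * (D * B * s - (D * A - (A\<^sup>2 + B\<^sup>2)) * (1 - c)) =
      (\<kappa> * D) * ((1 - \<beta>) * s\<^sup>2 - A * (1 - c)) + \<kappa> * (A\<^sup>2 + (1 - \<beta>)\<^sup>2 * s\<^sup>2) * (1 - c)"
    by (simp add: B_def algebra_simps power2_eq_square)
  also have "s\<^sup>2 = (1 - c) * (1 + c)"
    using cs by (simp add: algebra_simps power2_eq_square)
  also have "(\<kappa> * D) * ((1 - \<beta>) * ((1 - c) * (1 + c)) - A * (1 - c))
      + \<kappa> * (A\<^sup>2 + (1 - \<beta>)\<^sup>2 * ((1 - c) * (1 + c))) * (1 - c) = (1 - c) * ?Q"
    unfolding \<kappa>D A_def by (simp add: algebra_simps power2_eq_square)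
  finally have eq: "\<kappa> * (D * B * s - (D * A - (A\<^sup>2 + B\<^sup>2)) * (1 - c)) = (1 - c) * ?Q" .
  have "D * B * s \<le> (D * A - (A\<^sup>2 + B\<^sup>2)) * (1 - c) \<longleftrightarrow>
      \<kappa> * (D * B * s - (D * A - (A\<^sup>2 + B\<^sup>2)) * (1 - c)) \<le> 0"
    using \<open>\<kappa> > 0\<close> by (simp add: mult_le_0_iff)
  also have "\<dots> \<longleftrightarrow> ?Q \<le> 0"
    unfolding eq using \<open>c < 1\<close> by (simp add: mult_le_0_iff)
  finally show ?thesis .
qed

text \<open>The obtuse-angle condition defines a half-space, so checking it at the generators gives
  it on the whole hull.\<close>

lemma closest_point_convex_hull_eqI:
  fixes S :: "'a::euclidean_space set"
  assumes "finite S" "p \<in> S" and obtuse: "\<And>y. y \<in> S \<Longrightarrow> (x - p) \<bullet> (y - p) \<le> 0"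
  shows "closest_point (convex hull S) x = p"
proof (rule closest_point_unique[symmetric])
  have "S \<subseteq> {y. (x - p) \<bullet> y \<le> (x - p) \<bullet> p}"
    using obtuse by (auto simp: inner_diff_right)
  then have hull: "convex hull S \<subseteq> {y. (x - p) \<bullet> y \<le> (x - p) \<bullet> p}"
    by (rule hull_minimal) (rule convex_halfspace_le)
  show "\<forall>z\<in>convex hull S. dist x p \<le> dist x z"
  proof
    fix z assume "z \<in> convex hull S"
    then have "(x - p) \<bullet> (z - p) \<le> 0"
      using hull by (auto simp: inner_diff_right)
    moreover have "(norm (x - z))\<^sup>2 = (norm (x - p))\<^sup>2 - 2 * ((x - p) \<bullet> (z - p)) + (norm (z - p))\<^sup>2"
      unfolding power2_norm_eq_inner by (simp add: algebra_simps inner_commute)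
    ultimately have "(norm (x - p))\<^sup>2 \<le> (norm (x - z))\<^sup>2"
      by (smt (verit) zero_le_power2)
    then show "dist x p \<le> dist x z"
      by (simp add: dist_norm)
  qed
qed (use assms in \<open>auto intro: hull_inc compact_imp_closed finite_imp_compact_convex_hull\<close>)

section \<open>Necessity and sufficiency of the cycle condition\<close>

context
  fixes \<mu> L \<gamma> \<beta> A B D :: real and K :: nat
  defines "A \<equiv> 1 + \<beta> - \<mu> * \<gamma> - (1 + \<beta>) * cos (theta K)"
    and "B \<equiv> (1 - \<beta>) * sin (theta K)" and "D \<equiv> (L - \<mu>) * \<gamma>"
  assumes \<mu>: "0 < \<mu>" "\<mu> < L" and \<gamma>: "0 < \<gamma>" and K: "K \<ge> 2"
begin

lemma cycle_condition_necessary: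
  assumes f: "f \<in> smooth_strongly_convex \<mu> L" and cyc: "hb_cycles \<gamma> \<beta> f K (unity_root K)"
  shows "D * B * sin (theta K) \<le> (D * A - (A\<^sup>2 + B\<^sup>2)) * (1 - cos (theta K))"
proof -
  let ?\<theta> = "theta K" and ?u = "unity_root K"
  define w where "w = cycle_grad (1 + \<beta> - \<mu> * \<gamma>) \<beta> ?\<theta>"
  define h where "h = (\<lambda>x. f x - \<mu> / 2 * (norm x)\<^sup>2)"
  \<comment> \<open>The constant gap in the interpolation inequality between neighbours, over the
    common denominator \<open>D * \<gamma> > 0\<close>; the claim is
    \<open>e \<le> 0\<close>.\<close>
  define e where "e = (D * B * sin ?\<theta> - (D * A - (A\<^sup>2 + B\<^sup>2)) * (1 - cos ?\<theta>)) / (D * \<gamma>)"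
  have D: "D > 0"
    using \<mu> \<gamma> by (simp add: D_def)
  have "\<gamma> *\<^sub>R grad f (?u (Suc n)) = cycle_grad (1 + \<beta>) \<beta> ?\<theta> (Suc n * ?\<theta>)" for n
    using hb_cycles_unity_root_iff[OF K, of f] f cyc
    unfolding smooth_strongly_convex_def by blast
  then have scaled: "\<gamma> *\<^sub>R (grad f (?u (Suc n)) - \<mu> *\<^sub>R ?u (Suc n)) = w (Suc n * ?\<theta>)" for n
    unfolding w_def cycle_grad_shift by (simp add: scaleR_diff_right unity_root_eq mult.commute)
  have grad: "grad f (?u (Suc n)) - \<mu> *\<^sub>R ?u (Suc n) = (1 / \<gamma>) *\<^sub>R w (Suc n * ?\<theta>)" for n
    unfolding scaled[symmetric] using \<gamma> by simp
  have step: "h (?u (Suc n)) \<ge> h (?u (Suc (Suc n))) + e" for n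
  proof -
    define a where "a = Suc n * ?\<theta>"
    have a': "Suc (Suc n) * ?\<theta> = a + ?\<theta>"
      by (simp add: a_def algebra_simps)
    have "w (a + ?\<theta>) \<bullet> (circ a - circ (a + ?\<theta>)) = A * (cos ?\<theta> - 1) + B * sin ?\<theta>"
      unfolding w_def inner_diff_right inner_commute[of "cycle_grad _ _ _ _"] circ_inner_cycle_grad
      by (simp add: A_def B_def algebra_simps)
    moreover have "(norm (w a - w (a + ?\<theta>)))\<^sup>2 = 2 * (A\<^sup>2 + B\<^sup>2) * (1 - cos ?\<theta>)"
      unfolding w_def power2_norm_eq_inner inner_diff_left inner_diff_right cycle_grad_inner
      by (simp add: A_def B_def algebra_simps)
    moreover have "(norm ((1 / \<gamma>) *\<^sub>R w a - (1 / \<gamma>) *\<^sub>R w (a + ?\<theta>)))\<^sup>2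
        = (norm (w a - w (a + ?\<theta>)))\<^sup>2 / \<gamma>\<^sup>2"
      unfolding scaleR_diff_right[symmetric] by (simp add: power_divide)
    moreover have "h (?u (Suc n)) \<ge> h (?u (Suc (Suc n)))
        + ((1 / \<gamma>) *\<^sub>R w (a + ?\<theta>)) \<bullet> (circ a - circ (a + ?\<theta>))
        + (norm ((1 / \<gamma>) *\<^sub>R w a - (1 / \<gamma>) *\<^sub>R w (a + ?\<theta>)))\<^sup>2 / (2 * (L - \<mu>))"
      using smooth_strongly_convex_interpolation[OF f \<mu>(2), of "?u (Suc (Suc n))" "?u (Suc n)"]
      unfolding grad unfolding unity_root_eq a' a_def[symmetric] h_def .
    ultimately have "h (?u (Suc n)) \<ge> h (?u (Suc (Suc n)))
        + (A * (cos ?\<theta> - 1) + B * sin ?\<theta>) / \<gamma>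
        + 2 * (A\<^sup>2 + B\<^sup>2) * (1 - cos ?\<theta>) / \<gamma>\<^sup>2 / (2 * (L - \<mu>))"
      by simp
    moreover have "(A * (cos ?\<theta> - 1) + B * sin ?\<theta>) / \<gamma>
        + 2 * (A\<^sup>2 + B\<^sup>2) * (1 - cos ?\<theta>) / \<gamma>\<^sup>2 / (2 * (L - \<mu>)) = e"
    proof -
      have "2 * (A\<^sup>2 + B\<^sup>2) * (1 - cos ?\<theta>) / \<gamma>\<^sup>2 / (2 * (L - \<mu>)) =
          (A\<^sup>2 + B\<^sup>2) * (1 - cos ?\<theta>) / (D * \<gamma>)"
        using \<mu> \<gamma> by (simp add: D_def field_simps power2_eq_square)
      moreover have "(A * (cos ?\<theta> - 1) + B * sin ?\<theta>) / \<gamma> =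
          D * (A * (cos ?\<theta> - 1) + B * sin ?\<theta>) / (D * \<gamma>)"
        using D by simp
      moreover have "D * B * sin ?\<theta> - (D * A - (A\<^sup>2 + B\<^sup>2)) * (1 - cos ?\<theta>) =
          D * (A * (cos ?\<theta> - 1) + B * sin ?\<theta>) + (A\<^sup>2 + B\<^sup>2) * (1 - cos ?\<theta>)"
        by (simp add: algebra_simps)
      ultimately show ?thesis
        unfolding e_def by (simp only: add_divide_distrib)
    qed
    ultimately show ?thesis
      by simp
  qed
  \<comment> \<open>The chain starts at index 1 because the gradients are known at indices
    \<open>Suc n\<close>. For \<open>m = K\<close> it returns to its starting point.\<close>
  have "h (?u 1) \<ge> h (?u (Suc m)) + m * e" for m
  proof (induction m)
    case (Suc m)
    then show ?case
      using step[of m] by (simp add: algebra_simps)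
  qed simp
  from this[of K] have "real K * e \<le> 0"
    using unity_root_add_mult[OF K, of 1 1] by simp
  then have "e \<le> 0"
    using K by (simp add: mult_le_0_iff)
  then show ?thesis
    using mult_pos_pos[OF D \<gamma>] by (auto simp: e_def divide_le_0_iff)
qed

lemma cycle_condition_sufficient:
  assumes \<beta>: "\<beta> < 1"
    and cond: "D * B * sin (theta K) \<le> (D * A - (A\<^sup>2 + B\<^sup>2)) * (1 - cos (theta K))"
  shows "psi K \<mu> L \<gamma> \<beta> \<in> smooth_strongly_convex \<mu> L"
    and "hb_cycles \<gamma> \<beta> (psi K \<mu> L \<gamma> \<beta>) K (unity_root K)"
proof -
  let ?\<theta> = "theta K" and ?u = "unity_root K" and ?M = "cycle_matrix K \<mu> L \<gamma> \<beta>"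
  define w where "w = cycle_grad (1 + \<beta> - \<mu> * \<gamma>) \<beta> ?\<theta>"
  define S where "S = (\<lambda>t. ?M *v ?u t) ` {..<K}"
  have D: "D > 0"
    using \<mu> \<gamma> by (simp add: D_def)
  have M: "?M *v ?u t = (1 / D) *\<^sub>R w (t * ?\<theta>)" for t
    by (simp add: cycle_matrix_mult_unity_root D_def w_def)
  \<comment> \<open>It remains to see that each root projects onto its own vertex; the gradient of
    \<open>psi\<close> then has the prescribed values.\<close>
  have proj: "closest_point (convex hull S) (?u t) = ?M *v ?u t" for t
  proof (rule closest_point_convex_hull_eqI)
    show "?M *v ?u t \<in> S"
      using K by (auto simp: S_def unity_root_mod intro!: image_eqI[of _ _ "t mod K"])
    fix y assume "y \<in> S"
    then obtain s where s: "y = ?M *v ?u s"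
      by (auto simp: S_def)
    \<comment> \<open>Adding \<open>K * t\<close> to \<open>s\<close> leaves the root unchanged and
      makes the index difference a natural number, as the cotangent condition requires.\<close>
    define a b where "a = t * ?\<theta>" and "b = (s + K * t) * ?\<theta>"
    have y: "y = (1 / D) *\<^sub>R w b"
      using M[of "s + K * t"] unity_root_add_mult[OF K, of s t] by (simp add: s b_def)
    have "t \<le> s + K * t"
      using K by (simp add: trans_le_add2)
    then have "b - a = real (s + K * t - t) * ?\<theta>"
      by (simp add: a_def b_def of_nat_diff algebra_simps)
    then have "D * B * sin (b - a) \<le> (D * A - (A\<^sup>2 + B\<^sup>2)) * (1 - cos (b - a))"
      using cot_condition_all_multiples[OF K _ cond] \<beta> D sin_theta_nonneg[OF K]
      by (simp add: B_def)
    \<comment> \<open>Multiplied by \<open>D\<^sup>2\<close>, the obtuse-angle condition becomes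
      exactly the cotangent condition at the angle \<open>b - a\<close>.\<close>
    moreover have "D\<^sup>2 * ((circ a - (1 / D) *\<^sub>R w a) \<bullet> ((1 / D) *\<^sub>R w b - (1 / D) *\<^sub>R w a)) =
        D * (circ a \<bullet> w b - circ a \<bullet> w a) - (w a \<bullet> w b - w a \<bullet> w a)"
      using D unfolding scaleR_diff_right[symmetric]
      by (simp add: inner_diff_left inner_diff_right divide_simps power2_eq_square) (simp add: algebra_simps)
    moreover have "circ a \<bullet> w b - circ a \<bullet> w a = A * (cos (b - a) - 1) + B * sin (b - a)"
      unfolding w_def circ_inner_cycle_grad by (simp add: A_def B_def algebra_simps)
    moreover have "w a \<bullet> w b - w a \<bullet> w a = (A\<^sup>2 + B\<^sup>2) * (cos (b - a) - 1)"
      unfolding w_def cycle_grad_inner by (simp add: A_def B_def algebra_simps)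
    ultimately have "D\<^sup>2 * ((circ a - (1 / D) *\<^sub>R w a) \<bullet> ((1 / D) *\<^sub>R w b - (1 / D) *\<^sub>R w a)) \<le> 0"
      by (simp add: algebra_simps)
    then have "(circ a - (1 / D) *\<^sub>R w a) \<bullet> ((1 / D) *\<^sub>R w b - (1 / D) *\<^sub>R w a) \<le> 0"
      using D by (simp add: mult_le_0_iff)
    then show "(?u t - ?M *v ?u t) \<bullet> (y - ?M *v ?u t) \<le> 0"
      unfolding y M a_def by (simp only: unity_root_eq)
  qed (simp add: S_def)
  have psi: "psi K \<mu> L \<gamma> \<beta> =
      (\<lambda>x. L / 2 * (norm x)\<^sup>2 - (L - \<mu>) / 2 * (infdist x (convex hull S))\<^sup>2)"
    by (simp add: psi_def S_def fun_eq_iff)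
  have hull: "convex (convex hull S)" "closed (convex hull S)" "convex hull S \<noteq> {}"
    using K by (auto simp: S_def lessThan_empty_iff intro!: compact_imp_closed finite_imp_compact_convex_hull)
  show psi_in: "psi K \<mu> L \<gamma> \<beta> \<in> smooth_strongly_convex \<mu> L"
    unfolding psi using \<mu> by (intro smooth_strongly_convex_dist_regularised hull) simp
  have "\<gamma> *\<^sub>R grad (psi K \<mu> L \<gamma> \<beta>) (?u t) = cycle_grad (1 + \<beta>) \<beta> ?\<theta> (t * ?\<theta>)" for t
  proof -
    have "grad (psi K \<mu> L \<gamma> \<beta>) (?u t) = \<mu> *\<^sub>R ?u t + (L - \<mu>) *\<^sub>R (?M *v ?u t)"
      unfolding psi using \<mu> by (subst grad_dist_regularised[OF hull]) (simp_all add: proj)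
    \<comment> \<open>The factor \<open>L - \<mu>\<close> cancels against the one in
      \<open>M\<close>, and the term in \<open>\<mu> * \<gamma>\<close> undoes the shift in
      \<open>w\<close>.\<close>
    also have "\<gamma> *\<^sub>R \<dots> = (\<mu> * \<gamma>) *\<^sub>R circ (t * ?\<theta>) + w (t * ?\<theta>)"
      unfolding M using \<mu> \<gamma> by (simp add: unity_root_eq scaleR_add_right D_def mult.commute)
    finally show ?thesis
      by (simp add: w_def cycle_grad_shift)
  qed
  moreover have "psi K \<mu> L \<gamma> \<beta> differentiable_on UNIV"
    using psi_in by (simp add: smooth_strongly_convex_def)
  ultimately show "hb_cycles \<gamma> \<beta> (psi K \<mu> L \<gamma> \<beta>) K ?u"
    by (simp add: hb_cycles_unity_root_iff[OF K])
qed

end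

section \<open>The cycling region and the function \<open>psi\<close>\<close>

theorem theorem3p5:
  fixes \<mu> L \<kappa> :: real and K :: nat
  assumes "0 < \<mu>" and "\<mu> < L" and "\<kappa> = \<mu> / L" and "K \<ge> 2"
  shows "Omega_circ K \<mu> L =
      {(\<gamma>, \<beta>). (\<gamma>, \<beta>) \<in> Omega_cv L \<and>
         (\<mu> * \<gamma>)\<^sup>2
         - 2 * (\<beta> - cos (theta K) + \<kappa> * (1 - \<beta> * cos (theta K))) * (\<mu> * \<gamma>)
         + 2 * \<kappa> * (1 - cos (theta K)) * (1 + \<beta>\<^sup>2 - 2 * \<beta> * cos (theta K)) \<le> 0}
    \<and> (\<forall>(\<gamma>, \<beta>) \<in> Omega_circ K \<mu> L.
         hb_cycles \<gamma> \<beta> (psi K \<mu> L \<gamma> \<beta>) K (unity_root K))"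
proof -
  define Q where "Q = (\<lambda>\<gamma> \<beta>. (\<mu> * \<gamma>)\<^sup>2
         - 2 * (\<beta> - cos (theta K) + \<kappa> * (1 - \<beta> * cos (theta K))) * (\<mu> * \<gamma>)
         + 2 * \<kappa> * (1 - cos (theta K)) * (1 + \<beta>\<^sup>2 - 2 * \<beta> * cos (theta K)))"
  \<comment> \<open>The right-hand side is the cycle condition with \<open>A\<close>,
    \<open>B\<close> and \<open>D\<close> written out.\<close>
  have iff: "Q \<gamma> \<beta> \<le> 0 \<longleftrightarrow>
      (L - \<mu>) * \<gamma> * ((1 - \<beta>) * sin (theta K)) * sin (theta K) \<le>
      ((L - \<mu>) * \<gamma> * (1 + \<beta> - \<mu> * \<gamma> - (1 + \<beta>) * cos (theta K))
        - ((1 + \<beta> - \<mu> * \<gamma> - (1 + \<beta>) * cos (theta K))\<^sup>2 + ((1 - \<beta>) * sin (theta K))\<^sup>2))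
      * (1 - cos (theta K))" for \<gamma> \<beta>
    unfolding Q_def \<open>\<kappa> = \<mu> / L\<close>
    using assms cos_theta_less_1 by (intro region_polynomial_iff[symmetric]) auto
  have nec: "(\<gamma>, \<beta>) \<in> Omega_cv L \<and> Q \<gamma> \<beta> \<le> 0" if "(\<gamma>, \<beta>) \<in> Omega_circ K \<mu> L" for \<gamma> \<beta>
  proof -
    from that obtain f where "(\<gamma>, \<beta>) \<in> Omega_cv L" "f \<in> smooth_strongly_convex \<mu> L"
      "hb_cycles \<gamma> \<beta> f K (unity_root K)"
      unfolding Omega_circ_def by blast
    moreover from this have "0 < \<gamma>"
      by (simp add: Omega_cv_def)
    ultimately show ?thesis
      unfolding iff using cycle_condition_necessary assms(1,2,4) by blast
  qed
  have suf: "psi K \<mu> L \<gamma> \<beta> \<in> smooth_strongly_convex \<mu> L"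
    "hb_cycles \<gamma> \<beta> (psi K \<mu> L \<gamma> \<beta>) K (unity_root K)"
    if "(\<gamma>, \<beta>) \<in> Omega_cv L" "Q \<gamma> \<beta> \<le> 0" for \<gamma> \<beta>
  proof -
    have "0 < \<gamma>" "\<beta> < 1"
      using that by (simp_all add: Omega_cv_def)
    from cycle_condition_sufficient[OF assms(1,2) this(1) assms(4) this(2) that(2)[unfolded iff]]
    show "psi K \<mu> L \<gamma> \<beta> \<in> smooth_strongly_convex \<mu> L"
      "hb_cycles \<gamma> \<beta> (psi K \<mu> L \<gamma> \<beta>) K (unity_root K)" .
  qed
  have "Omega_circ K \<mu> L = {(\<gamma>, \<beta>). (\<gamma>, \<beta>) \<in> Omega_cv L \<and> Q \<gamma> \<beta> \<le> 0}"
    using nec suf unfolding Omega_circ_def by blast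
  \<comment> \<open>Any cycling function forces the inequality, and the inequality makes
    \<open>psi\<close> cycle.\<close>
  moreover have "\<forall>(\<gamma>, \<beta>) \<in> Omega_circ K \<mu> L.
      hb_cycles \<gamma> \<beta> (psi K \<mu> L \<gamma> \<beta>) K (unity_root K)"
    using nec suf(2) by blast
  ultimately show ?thesis
    unfolding Q_def ..
qed

end
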